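(* Let $M,L\ge1$ and $1\le N\le L$ be integers, let $\mathcal{K}\subseteq\{1,\ldots,M\}$ be non-empty, let $(\Sigma,\mu)$ be the product of measure spaces $(\Sigma_m,\mu_m)$, $1\le m\le M$, let $\psi_{m1},\ldots,\psi_{mL}$ be orthonormal in $L^2(\mu_m)$ for each $m$, and let $K$ and $p_N$ be the associated kernel and function defined in the context. Suppose that either $M\notin\mathcal{K}$, or $M\in\mathcal{K}$ and $\mathcal{K}\setminus\{M\}\neq\emptyset$. Set $\hat{\mathcal{K}}:=\mathcal{K}\setminus\{M\}$, $\hat\Sigma:=\prod_{m=1}^{M-1}\Sigma_m$, and $\hat\mu:=\bigotimes_{m=1}^{M-1}\mu_m$. Define a kernel $\hat K:\hat\Sigma^{2(M-1)}\to\mathbb{C}$ by $$\hat K(y_1,\ldots,y_{M-1};z_1,\ldots,z_{M-1}):=\sum_{\ell=1}^L\prod_{m=1}^{M-1}\phi_{m\ell}(y_m)\,\overline{\phi_{m\ell}(z_m)},$$ where for $m\le M-1$ and $y\in\hat\Sigma$ one reads $\phi_{m\ell}(y)=\psi_{m\ell}(y^{(m)})$ with $y^{(m)}\in\Sigma_m$ the $m$-th coordinate of $y$. Then the function $$\hat p_N\big((x_{nm})_{1\le n\le N,\,1\le m\le M-1}\big):=\int_{\Sigma_M^N}p_N\big((x_{nm})_{1\le n\le N,\,1\le m\le M}\big)\,\mu_M^{\otimes N}(d(x_{1M},\ldots,x_{NM}))$$ is a probability density with respect to the measure $\hat\mu^{\otimes N}$ on $\hat\Sigma^N$. Moreover,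 $\hat p_N$ is constructed from the kernel $\hat K$ and the set of indices $\hat{\mathcal{K}}$ in the same manner that $p_N$ is constructed from $K$ and $\mathcal{K}$; that is, for $x_1,\ldots,x_N\in\hat\Sigma$, $$\hat p_N(x_1,\ldots,x_N)=\left(\binom{L}{N}(N!)^{M-1}\right)^{-1}\mathrm{Det}_{\hat{\mathcal{K}}}(\hat{\mathbb{B}}),$$ where $\hat{\mathbb{B}}$ is the $2(M-1)$-way hypercubic array of length $N$ given by $$\hat{\mathbb{B}}(i_1,\ldots,i_{M-1};j_1,\ldots,j_{M-1}):=\hat K(x_{i_1},\ldots,x_{i_{M-1}};x_{j_1},\ldots,x_{j_{M-1}}).$$
   Context: **Hyperdeterminant.** For $N\ge1$, $\mathfrak{S}_N$ is the symmetric group on $\{1,\ldots,N\}$ and $\epsilon$ is the sign character. For a $2M$-way hypercubic array $\mathbb{A}(i_1,\ldots,i_M;j_1,\ldots,j_M)\in\mathbb{C}$, with all indices in $\{1,\ldots,N\}$, and $\mathcal{K}\subseteq\{1,\ldots,M\}$, define $$\mathrm{Det}_{\mathcal{K}}(\mathbb{A}) := \frac{1}{N!}\sum_{\sigma_1,\ldots,\sigma_M\in\mathfrak{S}_N}\ \sum_{\tau_1,\ldots,\tau_M\in\mathfrak{S}_N}\ \prod_{k\in\mathcal{K}}\epsilon(\sigma_k)\epsilon(\tau_k)\ \prod_{n=1}^N \mathbb{A}(\sigma_1(n),\ldots,\sigma_M(n);\tau_1(n),\ldots,\tau_M(n)).$$ The same definition with $M-1$ in place of $M$ applies to $2(M-1)$-way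 arrays. **Setting.** $\Sigma=\Sigma_1\times\cdots\times\Sigma_M$ with product measure $\mu=\mu_1\otimes\cdots\otimes\mu_M$. For each $1\le m\le M$, the functions $\psi_{m\ell}:\Sigma_m\to\mathbb{C}$, $1\le\ell\le L$, belong to $L^2(\mu_m)$ and are orthonormal there. Set $\phi_{m\ell}(x_1,\ldots,x_M):=\psi_{m\ell}(x_m)$ for $(x_1,\ldots,x_M)\in\Sigma$. The kernel $K:\Sigma^{2M}\to\mathbb{C}$ is $$K(y_1,\ldots,y_M;z_1,\ldots,z_M):=\sum_{\ell=1}^L\prod_{m=1}^M\phi_{m\ell}(y_m)\,\overline{\phi_{m\ell}(z_m)}.$$ **The functions $p_N$.** For $1\le N\le L$ and $x_1,\ldots,x_N\in\Sigma$, $$p_N(x_1,\ldots,x_N):=\left(\binom{L}{N}(N!)^M\right)^{-1}\mathrm{Det}_{\mathcal{K}}(\mathbb{B}),\qquad \mathbb{B}(i_1,\ldots,i_M;j_1,\ldots,j_M):=K(x_{i_1},\ldots,x_{i_M};x_{j_1},\ldots,x_{j_M}),$$ where $\mathbb{B}$ is a $2M$-way array of length $N$ in each direction. Writing $x_n=(x_{n1},\ldots,x_{nM})\in\Sigma$, $p_N$ is regarded as a function of $(x_{nm})_{1\le n\le N,\,1\le m\le M}$, with $x_{nm}\in\Sigma_m$. *)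

theory Defs
  imports "HOL-Probability.Probability" "HOL-Combinatorics.Permutations"
begin

text \<open>
  A point of \<open>\<Sigma>\<^sub>1 \<times> \<dots> \<times> \<Sigma>\<^sub>M\<close> is an extensional function on \<open>{1..M}\<close>, that is, an element of
  \<open>space (PiM {1..M} \<mu>)\<close>; the sets \<open>\<Sigma>\<^sub>m = space (\<mu> m)\<close> may be different subsets of the common type.
  No \<open>\<sigma>\<close>-finiteness is assumed of \<open>\<mu> m\<close>: by Caratheodory's theorem \<open>PiM\<close> over a finite index set has
  the product values on measurable rectangles for arbitrary factors, and square-integrable functions
  vanish off \<open>\<sigma>\<close>-finite sets, on whose products the product measure is unique.
  A configuration \<open>x\<^sub>1, \<dots>, x\<^sub>N\<close> is a function with \<open>x n m\<close> the \<open>m\<close>-th coordinate of \<open>x\<^sub>n\<close>.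
\<close>

text \<open>
  A \<open>2M\<close>-way array is a function of two multi-indices, each an extensional function on \<open>{1..M}\<close>
  with values in \<open>{1..N}\<close>.
\<close>

definition hyperdet ::
  "nat \<Rightarrow> nat \<Rightarrow> nat set \<Rightarrow> ((nat \<Rightarrow> nat) \<Rightarrow> (nat \<Rightarrow> nat) \<Rightarrow> complex) \<Rightarrow> complex" where
  "hyperdet M N \<K> A =
     1 / fact N *
     (\<Sum>\<sigma>\<in>{1..M} \<rightarrow>\<^sub>E {\<pi>. \<pi> permutes {1..N}}. \<Sum>\<tau>\<in>{1..M} \<rightarrow>\<^sub>E {\<pi>. \<pi> permutes {1..N}}.
        (\<Prod>k\<in>\<K>. of_int (sign (\<sigma> k)) * of_int (sign (\<tau> k))) *
        (\<Prod>n=1..N. A (\<lambda>m\<in>{1..M}. \<sigma> m n) (\<lambda>m\<in>{1..M}. \<tau> m n)))"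

definition orthonormal_L2 :: "'a measure \<Rightarrow> nat set \<Rightarrow> (nat \<Rightarrow> 'a \<Rightarrow> complex) \<Rightarrow> bool" where
  "orthonormal_L2 \<nu> I f \<longleftrightarrow>
     (\<forall>l\<in>I. f l \<in> borel_measurable \<nu> \<and> integrable \<nu> (\<lambda>t. (cmod (f l t))\<^sup>2)) \<and>
     (\<forall>l\<in>I. \<forall>l'\<in>I. (\<integral>t. f l t * cnj (f l' t) \<partial>\<nu>) = (if l = l' then 1 else 0))"

definition lift_coord :: "(nat \<Rightarrow> nat \<Rightarrow> 'a \<Rightarrow> complex) \<Rightarrow> nat \<Rightarrow> nat \<Rightarrow> (nat \<Rightarrow> 'a) \<Rightarrow> complex" where
  "lift_coord \<psi> m l x = \<psi> m l (x m)"

text \<open>The arguments \<open>y, z\<close> below are \<open>M\<close>-tuples of points of the product space.\<close>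

definition multi_kernel ::
  "nat \<Rightarrow> nat \<Rightarrow> (nat \<Rightarrow> nat \<Rightarrow> 'a \<Rightarrow> complex) \<Rightarrow> (nat \<Rightarrow> nat \<Rightarrow> 'a) \<Rightarrow> (nat \<Rightarrow> nat \<Rightarrow> 'a) \<Rightarrow> complex" where
  "multi_kernel M L \<psi> y z =
     (\<Sum>l=1..L. \<Prod>m=1..M. lift_coord \<psi> m l (y m) * cnj (lift_coord \<psi> m l (z m)))"

definition hyperdet_density ::
  "nat \<Rightarrow> nat \<Rightarrow> nat \<Rightarrow> ((nat \<Rightarrow> nat \<Rightarrow> 'a) \<Rightarrow> (nat \<Rightarrow> nat \<Rightarrow> 'a) \<Rightarrow> complex) \<Rightarrow> nat set \<Rightarrow>
    (nat \<Rightarrow> nat \<Rightarrow> 'a) \<Rightarrow> complex" where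
  "hyperdet_density M L N K \<K> x =
     inverse (of_nat (L choose N) * fact N ^ M) *
     hyperdet M N \<K> (\<lambda>i j. K (\<lambda>m\<in>{1..M}. x (i m)) (\<lambda>m\<in>{1..M}. x (j m)))"

text \<open>
  \<open>extend_config M N x u\<close> has coordinates \<open>x\<^sub>n\<^sub>m\<close> for \<open>m < M\<close>, taken from \<open>x\<close>, and \<open>x\<^sub>n\<^sub>M = u n\<close>.
\<close>

definition extend_config :: "nat \<Rightarrow> nat \<Rightarrow> (nat \<Rightarrow> nat \<Rightarrow> 'a) \<Rightarrow> (nat \<Rightarrow> 'a) \<Rightarrow> nat \<Rightarrow> nat \<Rightarrow> 'a" where
  "extend_config M N x u = (\<lambda>n\<in>{1..N}. (x n)(M := u n))"

text \<open>
  The densities are complex valued by construction, so being real and nonnegative is part of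
  what has to hold; the second conjunct makes \<open>Re\<close> in the third one harmless.
\<close>

definition is_probability_density :: "'b measure \<Rightarrow> ('b \<Rightarrow> complex) \<Rightarrow> bool" where
  "is_probability_density \<nu> f \<longleftrightarrow>
     f \<in> borel_measurable \<nu> \<and>
     (\<forall>x\<in>space \<nu>. f x \<in> \<real> \<and> 0 \<le> Re (f x)) \<and>
     prob_space (density \<nu> (\<lambda>x. ennreal (Re (f x))))"

end

theory Submission
  imports Defs
begin

text \<open>
  For a labelling \<open>l\<close> of \<open>{1..N}\<close> by \<open>{1..L}\<close> let \<open>D\<^sub>m\<close> be the \<open>N \<times> N\<close> determinant (if \<open>m \<in> \<K>\<close>) or permanent
  (if \<open>m \<notin> \<K>\<close>) with entries \<open>\<psi> m (l i) (x n m)\<close>. The kernel is a sum of \<open>L\<close> rank-one terms, and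
  expanding the hyperdeterminant gives a Cauchy--Binet type formula: up to a constant, \<open>p\<^sub>N\<close> is the sum
  over all \<open>l\<close> of the product over \<open>m\<close> of \<open>\<bar>D\<^sub>m\<bar>\<^sup>2\<close> (\<open>hyperdet_sum_of_rank_one\<close>). Because \<open>\<K>\<close> is nonempty,
  one of the factors is a determinant, and labellings with a repeated label contribute nothing
  (\<open>hyperdet_density_eq_sum_slater\<close>).

  The variables \<open>x n m\<close> of different directions \<open>m\<close> occur in different factors. By orthonormality the
  integral of \<open>\<bar>D\<^sub>m\<bar>\<^sup>2\<close> over its variables is \<open>fact N\<close> for every injective \<open>l\<close>, for determinants and permanents
  alike. Integrating out the last direction hence replaces the factor for \<open>m = M\<close> by \<open>fact N\<close> and
  leaves the formula for the remaining directions; this requires that the remaining directions still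
  contain a determinant, which is the hypothesis on \<open>\<K>\<close>. Integrating out all directions counts the
  injective labellings, whence the total mass one. Nonnegativity can be read off from the formula.

  The measures are not assumed to be \<open>\<sigma>\<close>-finite, so the Fubini theorem is not available as it stands.
  What is used instead is that a product of integrable functions of one variable each is integrable
  with respect to a finite product measure, with the expected integral (\<open>integral_PiM_prod\<close>). It is
  proved by showing that the product measure has the product values on rectangles for arbitrary
  factors (\<open>emeasure_PiM_rectangle\<close>) and by restricting to the \<open>\<sigma>\<close>-finite supports of the functions.
\<close>

section \<open>Finite products of arbitrary measures\<close>

text \<open>
  A disjoint decomposition of a rectangle is an identity between indicator functions, each of which
  is a product of functions of one coordinate. Integrating this identity in one coordinate after the
  other replaces every indicator by a measure. Each step is monotone convergence for a single
  \<open>M i\<close>; functions of several variables are never integrated, so the factors may be arbitrary.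
\<close>

lemma suminf_prod_emeasure_rectangles:
  fixes M :: "'i \<Rightarrow> 'a measure" and A :: "nat \<Rightarrow> 'i \<Rightarrow> 'a set"
  assumes "finite I"
    and A: "\<And>n i. i \<in> I \<Longrightarrow> A n i \<in> sets (M i)"
    and B: "\<And>i. i \<in> I \<Longrightarrow> B i \<in> sets (M i)"
    and disj: "disjoint_family (\<lambda>n. Pi\<^sub>E I (A n))"
    and union: "(\<Union>n. Pi\<^sub>E I (A n)) = Pi\<^sub>E I B"
  shows "(\<Sum>n. \<Prod>i\<in>I. emeasure (M i) (A n i)) = (\<Prod>i\<in>I. emeasure (M i) (B i))"
proof -
  \<comment> \<open>After integration over the coordinates in \<open>J\<close>, the indicator of the rectangle \<open>C\<close> has become
      \<open>part J C\<close>, a function of the remaining coordinates.\<close>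
  define part :: "'i set \<Rightarrow> ('i \<Rightarrow> 'a set) \<Rightarrow> ('i \<Rightarrow> 'a) \<Rightarrow> ennreal" where
    "part J C x = (\<Prod>i\<in>I. if i \<in> J then emeasure (M i) (C i) else indicator (C i) (x i))" for J C x
  have "(\<Sum>n. part J (A n) x) = part J B x" if "J \<subseteq> I" for J x
  proof -
    from that \<open>finite I\<close> have "finite J" by (rule finite_subset)
    then show ?thesis using that
    proof (induction J arbitrary: x rule: finite_induct)
      case empty
      have ind: "part {} C x = indicator (Pi\<^sub>E I C) (restrict x I)" for C
      proof (cases "\<forall>i\<in>I. x i \<in> C i")
        case True
        then show ?thesis by (simp add: part_def indicator_def)
      next
        case False
        then show ?thesis using \<open>finite I\<close>
          by (auto simp: part_def indicator_def PiE_iff intro!: prod_zero)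
      qed
      show ?case
        unfolding ind by (simp add: suminf_indicator[OF disj] union)
    next
      case (insert j J)
      then have j: "j \<in> I" "j \<notin> J" and J: "J \<subseteq> I" by auto
      have split: "part J C (x(j := t)) =
          indicator (C j) t * (\<Prod>i\<in>I - {j}. if i \<in> J then emeasure (M i) (C i) else indicator (C i) (x i))"
        for C t
        unfolding part_def using j \<open>finite I\<close>
        by (subst prod.remove[of I j]) (simp_all, intro arg_cong2[where f = "(*)"] prod.cong, simp_all add: indicator_def)
      have int: "part (insert j J) C x = (\<integral>\<^sup>+t. part J C (x(j := t)) \<partial>M j)"
        if "C j \<in> sets (M j)" for C
        unfolding split using that j \<open>finite I\<close>
        by (subst nn_integral_multc) (auto simp: part_def prod.remove[of I j] intro!: prod.cong)
      have meas: "(\<lambda>t. part J (A n) (x(j := t))) \<in> borel_measurable (M j)" for n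
        unfolding split using A j by measurable
      have "(\<Sum>n. part (insert j J) (A n) x) = (\<Sum>n. \<integral>\<^sup>+t. part J (A n) (x(j := t)) \<partial>M j)"
        using int A j by simp
      also have "\<dots> = (\<integral>\<^sup>+t. (\<Sum>n. part J (A n) (x(j := t))) \<partial>M j)"
        using meas by (simp add: nn_integral_suminf)
      also have "\<dots> = (\<integral>\<^sup>+t. part J B (x(j := t)) \<partial>M j)"
        using insert.IH J by simp
      also have "\<dots> = part (insert j J) B x"
        using int B j by simp
      finally show ?case .
    qed
  qed
  from this[of I undefined] show ?thesis
    by (simp add: part_def)
qed

text \<open>
  The difference of two rectangles \<open>\<Pi> X i\<close> and \<open>\<Pi> Y i\<close> splits according to the set \<open>T\<close> of
  coordinates at which a point lies in \<open>Y\<close>: every \<open>T \<noteq> I\<close> gives a rectangle. An empty index set has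
  to be excluded because its only rectangle is a singleton, so that the empty set is missing.
\<close>

lemma semiring_of_rectangles:
  assumes "finite I" "I \<noteq> {}"
  shows "semiring_of_sets (\<Pi>\<^sub>E i\<in>I. space (M i)) {Pi\<^sub>E I X |X. X \<in> (\<Pi> i\<in>I. sets (M i))}"
    (is "semiring_of_sets _ ?R")
proof
  show "?R \<subseteq> Pow (\<Pi>\<^sub>E i\<in>I. space (M i))"
    using sets.sets_into_space by (fastforce simp: Pi_iff intro!: PiE_mono)
  from \<open>I \<noteq> {}\<close> have "{} = Pi\<^sub>E I (\<lambda>_. {})" by auto
  moreover have "(\<lambda>_. {}) \<in> (\<Pi> i\<in>I. sets (M i))" by simp
  ultimately show "{} \<in> ?R" by (intro CollectI exI conjI)
next
  fix a b assume "a \<in> ?R" "b \<in> ?R"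
  then obtain X Y where X: "a = Pi\<^sub>E I X" "\<And>i. i \<in> I \<Longrightarrow> X i \<in> sets (M i)"
    and Y: "b = Pi\<^sub>E I Y" "\<And>i. i \<in> I \<Longrightarrow> Y i \<in> sets (M i)"
    by auto
  have "a \<inter> b = (\<Pi>\<^sub>E i\<in>I. X i \<inter> Y i)"
    by (simp add: X Y PiE_Int)
  moreover have "(\<lambda>i. X i \<inter> Y i) \<in> (\<Pi> i\<in>I. sets (M i))"
    using X Y by auto
  ultimately show "a \<inter> b \<in> ?R" by blast
  define piece where "piece T = (\<Pi>\<^sub>E i\<in>I. if i \<in> T then X i \<inter> Y i else X i - Y i)" for T
  have mem: "x \<in> piece T \<longleftrightarrow> x \<in> a \<and> T = {i\<in>I. x i \<in> Y i}" if "T \<subseteq> I" for x T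
    using that by (auto simp: piece_def X PiE_iff split: if_splits)
  show "\<exists>C\<subseteq>?R. finite C \<and> disjoint C \<and> a - b = \<Union>C"
  proof (intro exI conjI)
    let ?C = "piece ` {T. T \<subset> I}"
    have "(\<lambda>i. if i \<in> T then X i \<inter> Y i else X i - Y i) \<in> (\<Pi> i\<in>I. sets (M i))" for T
      using X Y by auto
    then show "?C \<subseteq> ?R" unfolding piece_def by blast
    have "{T. T \<subset> I} \<subseteq> Pow I" by blast
    then show "finite ?C"
      using \<open>finite I\<close> by (intro finite_imageI) (blast intro: finite_subset)
    show "disjoint ?C"
      by (auto simp: disjoint_def mem)
    show "a - b = \<Union>?C"
    proof (intro set_eqI iffI)
      fix x assume x: "x \<in> a - b"
      then have "x \<in> piece {i\<in>I. x i \<in> Y i}" "{i\<in>I. x i \<in> Y i} \<subset> I"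
        by (auto simp: mem X Y PiE_iff)
      then show "x \<in> \<Union>?C" by blast
    qed (auto simp: mem Y PiE_iff)
  qed
qed

text \<open>
  By Caratheodory's theorem, countable additivity on rectangles is all that is needed for a measure
  with these values to exist, and \<open>PiM\<close> is then one of them. Such measures can differ on other
  sets, but they agree within products of \<open>\<sigma>\<close>-finite sets.
\<close>

lemma emeasure_PiM_rectangle:
  fixes M :: "'i \<Rightarrow> 'a measure"
  assumes "finite I" and A: "\<And>i. i \<in> I \<Longrightarrow> A i \<in> sets (M i)"
  shows "emeasure (PiM I M) (Pi\<^sub>E I A) = (\<Prod>i\<in>I. emeasure (M i) (A i))"
proof (cases "I = {}")
  case True
  then show ?thesis by simp
next
  case False
  define G where "G = (\<lambda>(J, X). prod_emb I M J (Pi\<^sub>E J X) :: ('i \<Rightarrow> 'a) set)"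
  define val where "val = (\<lambda>(J, X). \<Prod>j\<in>J \<union> {i\<in>I. emeasure (M i) (space (M i)) \<noteq> 1}.
    if j \<in> J then emeasure (M j) (X j) else emeasure (M j) (space (M j)))"
  define Idx where "Idx = {(J, X). (J \<noteq> {} \<or> I = {}) \<and> finite J \<and> J \<subseteq> I \<and> X \<in> (\<Pi> j\<in>J. sets (M j))}"
  define full where "full = (\<lambda>(J, X) i. if i \<in> J then X i else space (M i) :: 'a set)"
  have full_sets: "full p i \<in> sets (M i)" if "p \<in> Idx" "i \<in> I" for p i
    using that by (cases p) (auto simp: full_def Idx_def Pi_iff)
  have G_eq: "G p = Pi\<^sub>E I (full p)" if "p \<in> Idx" for p
    using that unfolding G_def full_def Idx_def
    by (clarify, simp, intro prod_emb_PiE) (auto simp: Pi_iff sets.sets_into_space)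
  have val_eq: "val p = (\<Prod>i\<in>I. emeasure (M i) (full p i))" if "p \<in> Idx" for p
    using that \<open>finite I\<close> unfolding val_def full_def Idx_def
    by (auto intro!: prod.mono_neutral_cong_left split: if_splits)
  have add: "(\<Sum>n. val (p n)) = val q"
    if "p \<in> UNIV \<rightarrow> Idx" "q \<in> Idx" "disjoint_family (G \<circ> p)" "(\<Union>n. G (p n)) = G q" for p :: "nat \<Rightarrow> _" and q
  proof -
    have p: "p n \<in> Idx" for n using that by auto
    show ?thesis
      unfolding val_eq[OF p] val_eq[OF that(2)]
      using that p by (intro suminf_prod_emeasure_rectangles \<open>finite I\<close> full_sets) (auto simp: G_eq comp_def)
  qed
  have empty: "val p = 0" if p: "p \<in> Idx" "G p = {}" for p
  proof -
    from p obtain i where "i \<in> I" "full p i = {}"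
      by (auto simp: G_eq PiE_eq_empty_iff)
    then show ?thesis
      using \<open>finite I\<close> by (auto simp: val_eq[OF p(1)] intro!: prod_zero bexI[of _ i])
  qed
  \<comment> \<open>The same rectangle may be written with different index sets or factors; the values agree, by
      additivity for the decomposition into one copy of itself and empty rectangles.\<close>
  have inj: "val p = val q" if "p \<in> Idx" "q \<in> Idx" "G p = G q" for p q
  proof -
    from False obtain i where "i \<in> I" by blast
    let ?e = "({i}, \<lambda>_. {}) :: 'i set \<times> ('i \<Rightarrow> 'a set)"
    have e: "?e \<in> Idx" "G ?e = {}"
      using \<open>i \<in> I\<close> by (auto simp: Idx_def G_def)
    let ?s = "\<lambda>n::nat. if n = 0 then p else ?e"
    have "(\<Sum>n. val (?s n)) = val q"
      using that e by (intro add) (auto simp: disjoint_family_on_def split: if_splits)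
    moreover have "(\<Sum>n. val (?s n)) = (\<Sum>n\<in>{0}. val (?s n))"
      using e by (intro suminf_finite) (auto simp: empty)
    ultimately show ?thesis by simp
  qed
  have "(I, A) \<in> Idx"
    using assms by (auto simp: Idx_def False)
  have "emeasure (PiM I M) (G (I, A)) = val (I, A)"
  proof (rule extend_measure_caratheodory[where G = G and \<mu> = val and I = Idx and \<Omega> = "\<Pi>\<^sub>E i\<in>I. space (M i)"])
    show "PiM I M = extend_measure (\<Pi>\<^sub>E i\<in>I. space (M i)) Idx G val"
      unfolding PiM_def Idx_def G_def val_def ..
    show "(I, A) \<in> Idx" by fact
    have "G ` Idx = prod_algebra I M"
      unfolding prod_algebra_def G_def Idx_def ..
    then show "semiring_of_sets (\<Pi>\<^sub>E i\<in>I. space (M i)) (G ` Idx)"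
      using semiring_of_rectangles[OF \<open>finite I\<close> False, of M] prod_algebra_eq_finite[OF \<open>finite I\<close>, of M]
      by simp
  qed (rule zero_le | fact empty inj | rule add; assumption)+
  moreover have "G (I, A) = Pi\<^sub>E I A"
    unfolding G_eq[OF \<open>(I, A) \<in> Idx\<close>] by (intro PiE_cong) (simp add: full_def)
  moreover have "val (I, A) = (\<Prod>i\<in>I. emeasure (M i) (A i))"
    unfolding val_eq[OF \<open>(I, A) \<in> Idx\<close>] by (intro prod.cong) (simp_all add: full_def)
  ultimately show ?thesis by simp
qed

text \<open>
  By Markov's inequality each set where \<open>1 \<le> n * norm (f x)\<close> has finite measure; these sets exhaust
  the support of \<open>f\<close>, and what is left is null for the restricted measure.
\<close>

lemma sigma_finite_density_support:
  fixes f :: "'a \<Rightarrow> 'b::{banach, second_countable_topology}"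
  assumes f: "integrable M f"
  shows "sigma_finite_measure (density M (\<lambda>x. indicator {x\<in>space M. f x \<noteq> 0} x))"
proof
  note [measurable] = borel_measurable_integrable[OF f]
  define S where "S = {x\<in>space M. f x \<noteq> 0}"
  have [measurable]: "S \<in> sets M" unfolding S_def by measurable
  define T where "T n = {x\<in>space M. 1 \<le> real n * norm (f x)}" for n
  have [measurable]: "T n \<in> sets M" for n unfolding T_def by measurable
  have fin: "emeasure M (T n) < \<infinity>" for n
  proof -
    have "emeasure M (T n) \<le> emeasure M {x \<in> space M. 1 \<le> ennreal (real n) * ennreal (norm (f x))}"
      by (intro emeasure_mono) (auto simp: T_def simp flip: ennreal_mult)
    also have "\<dots> \<le> ennreal (real n) * (\<integral>\<^sup>+x. ennreal (norm (f x)) * indicator (space M) x \<partial>M)"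
      by (rule nn_integral_Markov_inequality) auto
    also have "\<dots> < \<infinity>"
      using f by (auto simp: integrable_iff_bounded ennreal_mult_less_top cong: nn_integral_cong)
    finally show ?thesis .
  qed
  have cover: "space M \<subseteq> (space M - S) \<union> (\<Union>n. T n)"
  proof
    fix x assume x: "x \<in> space M"
    show "x \<in> (space M - S) \<union> (\<Union>n. T n)"
    proof (cases "f x = 0")
      case False
      then obtain n where "1 < real n * norm (f x)"
        using reals_Archimedean3[of "norm (f x)"] by auto
      with x have "x \<in> T n" by (simp add: T_def)
      then show ?thesis by blast
    qed (use x in \<open>auto simp: S_def\<close>)
  qed
  show "\<exists>A. countable A \<and> A \<subseteq> sets (density M (indicator S)) \<and> \<Union>A = space (density M (indicator S)) \<and>
    (\<forall>a\<in>A. emeasure (density M (indicator S)) a \<noteq> \<infinity>)"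
  proof (intro exI conjI)
    let ?A = "insert (space M - S) (range T)"
    show "countable ?A" by auto
    show "?A \<subseteq> sets (density M (indicator S))" by auto
    show "\<Union>?A = space (density M (indicator S))"
      using cover by (auto simp: T_def)
    have "emeasure (density M (indicator S)) (space M - S) = 0"
      by (subst emeasure_density) (auto simp flip: indicator_inter_arith)
    moreover have "emeasure (density M (indicator S)) (T n) \<noteq> \<infinity>" for n
    proof -
      have "emeasure (density M (indicator S)) (T n) \<le> emeasure M (T n)"
        by (subst emeasure_density)
          (auto simp flip: indicator_inter_arith intro!: emeasure_mono)
      with fin[of n] show ?thesis by (auto simp: top_unique)
    qed
    ultimately show "\<forall>a\<in>?A. emeasure (density M (indicator S)) a \<noteq> \<infinity>" by auto
  qed
qed

text \<open>
  The integrand vanishes off the product of the supports of the factors. On this product the measure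
  \<open>PiM I M\<close> agrees with the product of the \<open>\<sigma>\<close>-finite measures obtained by restricting each \<open>M i\<close> to the
  support of \<open>f i\<close>, since both have the same values on rectangles. The formula for \<open>\<sigma>\<close>-finite
  products therefore carries over to arbitrary factors.
\<close>

lemma
  fixes f :: "'i \<Rightarrow> 'a \<Rightarrow> 'b::{real_normed_field, banach, second_countable_topology}"
  assumes "finite I" and f: "\<And>i. i \<in> I \<Longrightarrow> integrable (M i) (f i)"
  shows integrable_PiM_prod: "integrable (PiM I M) (\<lambda>x. \<Prod>i\<in>I. f i (x i))"
    and integral_PiM_prod: "(\<integral>x. (\<Prod>i\<in>I. f i (x i)) \<partial>PiM I M) = (\<Prod>i\<in>I. \<integral>t. f i t \<partial>M i)"
proof -
  define S where "S i = {t\<in>space (M i). f i t \<noteq> 0}" for i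
  \<comment> \<open>The locale of \<open>\<sigma>\<close>-finite products constrains the measure at every index, including those
      outside \<open>I\<close>, where the empty space serves as a dummy.\<close>
  define \<nu> where "\<nu> i = (if i \<in> I then density (M i) (\<lambda>t. ennreal (indicator (S i) t)) else count_space {})" for i
  note [measurable] = borel_measurable_integrable[OF f]
  have S [measurable]: "S i \<in> sets (M i)" if "i \<in> I" for i
    using that unfolding S_def by measurable
  interpret product_sigma_finite \<nu>
  proof (rule product_sigma_finite.intro)
    fix i show "sigma_finite_measure (\<nu> i)"
      using sigma_finite_density_support[OF f, of i]
      by (auto simp: \<nu>_def S_def ennreal_indicator intro: sigma_finite_measure_count_space_finite)
  qed
  have [measurable]: "Pi\<^sub>E I S \<in> sets (PiM I M)"
    using \<open>finite I\<close> S by (rule sets_PiM_I_finite)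
  have restr: "density (PiM I M) (\<lambda>x. ennreal (indicator (Pi\<^sub>E I S) x)) = PiM I \<nu>"
  proof (rule PiM_eqI)
    show "sets (density (PiM I M) (\<lambda>x. ennreal (indicator (Pi\<^sub>E I S) x))) = sets (PiM I \<nu>)"
      unfolding sets_density by (intro sets_PiM_cong) (auto simp: \<nu>_def)
    fix A assume "\<And>i. i \<in> I \<Longrightarrow> A i \<in> sets (\<nu> i)"
    then have A [measurable]: "\<And>i. i \<in> I \<Longrightarrow> A i \<in> sets (M i)"
      by (simp add: \<nu>_def)
    have "emeasure (density (PiM I M) (\<lambda>x. ennreal (indicator (Pi\<^sub>E I S) x))) (Pi\<^sub>E I A)
        = emeasure (PiM I M) (Pi\<^sub>E I (\<lambda>i. S i \<inter> A i))"
      using \<open>finite I\<close> A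
      by (subst emeasure_density)
        (auto simp: ennreal_indicator PiE_Int simp flip: indicator_inter_arith intro!: sets_PiM_I_finite)
    also have "\<dots> = (\<Prod>i\<in>I. emeasure (M i) (S i \<inter> A i))"
      using \<open>finite I\<close> A S by (intro emeasure_PiM_rectangle) auto
    also have "\<dots> = (\<Prod>i\<in>I. emeasure (\<nu> i) (A i))"
      using A S by (intro prod.cong refl)
        (simp add: \<nu>_def emeasure_density ennreal_indicator flip: indicator_inter_arith)
    finally show "emeasure (density (PiM I M) (\<lambda>x. ennreal (indicator (Pi\<^sub>E I S) x))) (Pi\<^sub>E I A)
        = (\<Prod>i\<in>I. emeasure (\<nu> i) (A i))" .
  qed fact
  have f\<nu>: "integrable (\<nu> i) (f i)" and int\<nu>: "(\<integral>t. f i t \<partial>\<nu> i) = (\<integral>t. f i t \<partial>M i)" if "i \<in> I" for i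
  proof -
    note [measurable] = S[OF that]
    have eq: "indicat_real (S i) t *\<^sub>R f i t = f i t" if "t \<in> space (M i)" for t
      using that by (auto simp: S_def indicator_def)
    have \<nu>i: "\<nu> i = density (M i) (\<lambda>t. ennreal (indicator (S i) t))"
      using that by (simp add: \<nu>_def)
    have "integrable (\<nu> i) (f i) \<longleftrightarrow> integrable (M i) (\<lambda>t. indicat_real (S i) t *\<^sub>R f i t)"
      unfolding \<nu>i using f[OF that] by (intro integrable_density) auto
    also have "\<dots> \<longleftrightarrow> integrable (M i) (f i)"
      using eq by (intro Bochner_Integration.integrable_cong) auto
    finally show "integrable (\<nu> i) (f i)"
      using f[OF that] by simp
    have "(\<integral>t. f i t \<partial>\<nu> i) = (\<integral>t. indicat_real (S i) t *\<^sub>R f i t \<partial>M i)"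
      unfolding \<nu>i using f[OF that] by (intro integral_density) auto
    also have "\<dots> = (\<integral>t. f i t \<partial>M i)"
      using eq by (intro Bochner_Integration.integral_cong) auto
    finally show "(\<integral>t. f i t \<partial>\<nu> i) = (\<integral>t. f i t \<partial>M i)" .
  qed
  let ?F = "\<lambda>x. \<Prod>i\<in>I. f i (x i)"
  have [measurable]: "?F \<in> borel_measurable (PiM I M)"
    by measurable
  have eq: "indicat_real (Pi\<^sub>E I S) x *\<^sub>R ?F x = ?F x" if "x \<in> space (PiM I M)" for x
  proof (cases "x \<in> Pi\<^sub>E I S")
    case False
    with that obtain i where "i \<in> I" "f i (x i) = 0"
      by (auto simp: S_def space_PiM PiE_iff)
    then have "?F x = 0"
      using \<open>finite I\<close> by (auto intro: prod_zero)
    then show ?thesis by simp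
  qed simp
  have "integrable (PiM I \<nu>) ?F"
    using \<open>finite I\<close> f\<nu> by (rule product_integrable_prod)
  also have "integrable (PiM I \<nu>) ?F \<longleftrightarrow> integrable (PiM I M) (\<lambda>x. indicat_real (Pi\<^sub>E I S) x *\<^sub>R ?F x)"
    unfolding restr[symmetric] by (intro integrable_density) auto
  also have "\<dots> \<longleftrightarrow> integrable (PiM I M) ?F"
    using eq by (intro Bochner_Integration.integrable_cong) auto
  finally show "integrable (PiM I M) ?F" .
  have "(\<integral>x. ?F x \<partial>PiM I M) = (\<integral>x. indicat_real (Pi\<^sub>E I S) x *\<^sub>R ?F x \<partial>PiM I M)"
    using eq by (intro Bochner_Integration.integral_cong) auto
  also have "\<dots> = (\<integral>x. ?F x \<partial>PiM I \<nu>)"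
    unfolding restr[symmetric] by (intro integral_density[symmetric]) auto
  also have "\<dots> = (\<Prod>i\<in>I. \<integral>t. f i t \<partial>\<nu> i)"
    using \<open>finite I\<close> f\<nu> by (rule product_integral_prod)
  also have "\<dots> = (\<Prod>i\<in>I. \<integral>t. f i t \<partial>M i)"
    using int\<nu> by simp
  finally show "(\<integral>x. ?F x \<partial>PiM I M) = (\<Prod>i\<in>I. \<integral>t. f i t \<partial>M i)" .
qed

section \<open>Hyperdeterminants of sums of rank-one arrays\<close>

text \<open>
  Directions in \<open>\<K>\<close> carry the sign character and the others the trivial one. With the flag
  \<open>s\<close> selecting the character, both cases can be treated at once: \<open>det_or_perm\<close> is a
  determinant for \<open>s = True\<close> and a permanent for \<open>s = False\<close>.
\<close>

definition perm_weight :: "bool \<Rightarrow> (nat \<Rightarrow> nat) \<Rightarrow> complex" where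
  "perm_weight s \<pi> = (if s then of_int (sign \<pi>) else 1)"

definition det_or_perm :: "nat \<Rightarrow> bool \<Rightarrow> (nat \<Rightarrow> nat \<Rightarrow> complex) \<Rightarrow> complex" where
  "det_or_perm N s A = (\<Sum>\<pi> | \<pi> permutes {1..N}. perm_weight s \<pi> * (\<Prod>n=1..N. A (\<pi> n) n))"

lemma perm_weight_square [simp]: "perm_weight s \<pi> * perm_weight s \<pi> = 1"
  by (simp add: perm_weight_def flip: of_int_mult)

lemma cnj_perm_weight [simp]: "cnj (perm_weight s \<pi>) = perm_weight s \<pi>"
  by (simp add: perm_weight_def)

lemma perm_weight_inv:
  assumes "\<pi> permutes {1..N}"
  shows "perm_weight s (inv \<pi>) = perm_weight s \<pi>"
  using permutes_imp_permutation[OF _ assms] by (simp add: perm_weight_def sign_inverse)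

lemma det_or_perm_transpose:
  "det_or_perm N s A = (\<Sum>\<pi> | \<pi> permutes {1..N}. perm_weight s \<pi> * (\<Prod>n=1..N. A n (\<pi> n)))"
proof -
  have "det_or_perm N s A =
      (\<Sum>\<pi> | \<pi> permutes {1..N}. perm_weight s (inv \<pi>) * (\<Prod>n=1..N. A (inv \<pi> n) n))"
    unfolding det_or_perm_def by (rule sum_permutations_inverse)
  also have "\<dots> = (\<Sum>\<pi> | \<pi> permutes {1..N}. perm_weight s \<pi> * (\<Prod>n=1..N. A n (\<pi> n)))"
  proof (intro sum.cong refl)
    fix \<pi> assume "\<pi> \<in> {\<pi>. \<pi> permutes {1..N}}"
    then have \<pi>: "\<pi> permutes {1..N}" by simp
    have "(\<Prod>n=1..N. A n (\<pi> n)) = (\<Prod>n=1..N. A (inv \<pi> n) (\<pi> (inv \<pi> n)))"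
      using prod.permute[OF permutes_inv[OF \<pi>], of "\<lambda>n. A n (\<pi> n)"] by (simp add: comp_def)
    then show "perm_weight s (inv \<pi>) * (\<Prod>n=1..N. A (inv \<pi> n) n) =
        perm_weight s \<pi> * (\<Prod>n=1..N. A n (\<pi> n))"
      using \<pi> by (simp add: perm_weight_inv permutes_inverses)
  qed
  finally show ?thesis .
qed

lemma det_or_perm_identical_rows:
  assumes ab: "a \<in> {1..N}" "b \<in> {1..N}" "a \<noteq> b" and rows: "\<And>n. A a n = A b n"
  shows "det_or_perm N True A = 0"
proof -
  let ?t = "Transposition.transpose a b"
  have "det_or_perm N True A =
      (\<Sum>\<pi> | \<pi> permutes {1..N}. perm_weight True (?t \<circ> \<pi>) * (\<Prod>n=1..N. A ((?t \<circ> \<pi>) n) n))"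
    unfolding det_or_perm_def
    using ab by (intro setum_permutations_compose_left permutes_swap_id)
  also have "\<dots> = (\<Sum>\<pi> | \<pi> permutes {1..N}. - (perm_weight True \<pi> * (\<Prod>n=1..N. A (\<pi> n) n)))"
  proof (intro sum.cong refl)
    fix \<pi> assume "\<pi> \<in> {\<pi>. \<pi> permutes {1..N}}"
    then have "permutation \<pi>" by (auto intro: permutes_imp_permutation[of "{1..N}"])
    then have "perm_weight True (?t \<circ> \<pi>) = - perm_weight True \<pi>"
      using ab by (simp add: perm_weight_def sign_compose permutation_swap_id sign_swap_id)
    moreover have "A ((?t \<circ> \<pi>) n) n = A (\<pi> n) n" for n
      by (simp add: Transposition.transpose_def rows)
    ultimately show "perm_weight True (?t \<circ> \<pi>) * (\<Prod>n=1..N. A ((?t \<circ> \<pi>) n) n) =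
        - (perm_weight True \<pi> * (\<Prod>n=1..N. A (\<pi> n) n))"
      by simp
  qed
  also have "\<dots> = - det_or_perm N True A"
    by (simp add: det_or_perm_def sum_negf)
  finally show ?thesis by simp
qed

text \<open>
  This is the analogue of the Cauchy--Binet formula. Expanding the product over \<open>n\<close> chooses a term
  \<open>l n\<close> for every \<open>n\<close>. For a fixed choice \<open>l\<close> the summand factorises over the directions \<open>m\<close>, and the
  sums over the permutations \<open>\<sigma> m\<close> and \<open>\<tau> m\<close> can be carried out independently of each other.
\<close>

lemma hyperdet_sum_of_rank_one:
  fixes f g :: "nat \<Rightarrow> 'l \<Rightarrow> nat \<Rightarrow> complex"
  assumes "\<K> \<subseteq> {1..M}" and "finite \<Lambda>"
  shows "hyperdet M N \<K> (\<lambda>i j. \<Sum>a\<in>\<Lambda>. \<Prod>m=1..M. f m a (i m) * g m a (j m)) =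
    1 / fact N * (\<Sum>l\<in>{1..N} \<rightarrow>\<^sub>E \<Lambda>. \<Prod>m=1..M.
      det_or_perm N (m \<in> \<K>) (\<lambda>i. f m (l i)) * det_or_perm N (m \<in> \<K>) (\<lambda>i. g m (l i)))"
proof -
  let ?P = "{\<pi>. \<pi> permutes {1..N}}"
  let ?S = "{1..M} \<rightarrow>\<^sub>E ?P"
  define w where "w \<sigma> = (\<Prod>m=1..M. perm_weight (m \<in> \<K>) (\<sigma> m))" for \<sigma> :: "nat \<Rightarrow> nat \<Rightarrow> nat"
  define mono where "mono f l \<sigma> = (\<Prod>m=1..M. \<Prod>n=1..N. f m (l n) (\<sigma> m n))"
    for f :: "nat \<Rightarrow> 'l \<Rightarrow> nat \<Rightarrow> complex" and l :: "nat \<Rightarrow> 'l" and \<sigma> :: "nat \<Rightarrow> nat \<Rightarrow> nat"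
  have finP: "finite ?P" by (simp add: finite_permutations)
  have w: "(\<Prod>k\<in>\<K>. of_int (sign (\<sigma> k)) * of_int (sign (\<tau> k))) = w \<sigma> * w \<tau>" for \<sigma> \<tau>
  proof -
    have "w \<sigma> = (\<Prod>k\<in>\<K>. of_int (sign (\<sigma> k)))" for \<sigma>
      unfolding w_def perm_weight_def using assms
      by (intro prod.mono_neutral_cong_right) auto
    then show ?thesis by (simp add: prod.distrib)
  qed
  have entries: "(\<Prod>n=1..N. \<Sum>a\<in>\<Lambda>. \<Prod>m=1..M.
        f m a ((\<lambda>m\<in>{1..M}. \<sigma> m n) m) * g m a ((\<lambda>m\<in>{1..M}. \<tau> m n) m)) =
      (\<Sum>l\<in>{1..N} \<rightarrow>\<^sub>E \<Lambda>. mono f l \<sigma> * mono g l \<tau>)" for \<sigma> \<tau>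
  proof -
    have "(\<Prod>n=1..N. \<Sum>a\<in>\<Lambda>. \<Prod>m=1..M.
        f m a ((\<lambda>m\<in>{1..M}. \<sigma> m n) m) * g m a ((\<lambda>m\<in>{1..M}. \<tau> m n) m)) =
      (\<Sum>l\<in>{1..N} \<rightarrow>\<^sub>E \<Lambda>. \<Prod>n=1..N. \<Prod>m=1..M. f m (l n) (\<sigma> m n) * g m (l n) (\<tau> m n))"
      using \<open>finite \<Lambda>\<close> by (subst prod_sum_PiE) (auto intro!: sum.cong prod.cong)
    also have "\<dots> = (\<Sum>l\<in>{1..N} \<rightarrow>\<^sub>E \<Lambda>. mono f l \<sigma> * mono g l \<tau>)"
      by (subst prod.swap) (simp add: mono_def prod.distrib)
    finally show ?thesis .
  qed
  have collect: "(\<Sum>\<sigma>\<in>?S. w \<sigma> * mono f l \<sigma>) = (\<Prod>m=1..M. det_or_perm N (m \<in> \<K>) (\<lambda>i. f m (l i)))"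
    for f :: "nat \<Rightarrow> 'l \<Rightarrow> nat \<Rightarrow> complex" and l
    unfolding det_or_perm_transpose w_def mono_def
    using finP by (subst prod_sum_PiE) (simp_all add: prod.distrib)
  have "(\<Sum>\<sigma>\<in>?S. \<Sum>\<tau>\<in>?S. (w \<sigma> * w \<tau>) * (\<Sum>l\<in>{1..N} \<rightarrow>\<^sub>E \<Lambda>. mono f l \<sigma> * mono g l \<tau>)) =
      (\<Sum>l\<in>{1..N} \<rightarrow>\<^sub>E \<Lambda>. (\<Sum>\<sigma>\<in>?S. w \<sigma> * mono f l \<sigma>) * (\<Sum>\<tau>\<in>?S. w \<tau> * mono g l \<tau>))"
  proof -
    have "(\<Sum>\<sigma>\<in>?S. \<Sum>\<tau>\<in>?S. (w \<sigma> * w \<tau>) * (\<Sum>l\<in>{1..N} \<rightarrow>\<^sub>E \<Lambda>. mono f l \<sigma> * mono g l \<tau>)) =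
        (\<Sum>\<sigma>\<in>?S. \<Sum>\<tau>\<in>?S. \<Sum>l\<in>{1..N} \<rightarrow>\<^sub>E \<Lambda>. (w \<sigma> * mono f l \<sigma>) * (w \<tau> * mono g l \<tau>))"
      by (simp only: sum_distrib_left mult_ac)
    also have "\<dots> = (\<Sum>\<sigma>\<in>?S. \<Sum>l\<in>{1..N} \<rightarrow>\<^sub>E \<Lambda>. \<Sum>\<tau>\<in>?S. (w \<sigma> * mono f l \<sigma>) * (w \<tau> * mono g l \<tau>))"
      by (intro sum.cong refl sum.swap)
    also have "\<dots> = (\<Sum>l\<in>{1..N} \<rightarrow>\<^sub>E \<Lambda>. \<Sum>\<sigma>\<in>?S. \<Sum>\<tau>\<in>?S. (w \<sigma> * mono f l \<sigma>) * (w \<tau> * mono g l \<tau>))"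
      by (rule sum.swap)
    finally show ?thesis by (simp only: sum_product)
  qed
  also have "\<dots> = (\<Sum>l\<in>{1..N} \<rightarrow>\<^sub>E \<Lambda>. \<Prod>m=1..M.
      det_or_perm N (m \<in> \<K>) (\<lambda>i. f m (l i)) * det_or_perm N (m \<in> \<K>) (\<lambda>i. g m (l i)))"
    unfolding collect by (simp add: prod.distrib)
  finally show ?thesis
    unfolding hyperdet_def w entries by simp
qed

section \<open>Slater determinants and permanents\<close>

definition inj_labels :: "nat \<Rightarrow> nat \<Rightarrow> (nat \<Rightarrow> nat) set" where
  "inj_labels N L = {l \<in> {1..N} \<rightarrow>\<^sub>E {1..L}. inj_on l {1..N}}"

lemma finite_inj_labels [simp]: "finite (inj_labels N L)"
  by (auto simp: inj_labels_def intro!: finite_subset[OF _ finite_PiE[of "{1..N}" "\<lambda>_. {1..L}"]])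

lemma card_inj_labels:
  assumes "N \<le> L"
  shows "card (inj_labels N L) = (L choose N) * fact N"
proof -
  have "card (inj_labels N L) = (\<Prod>i=0..<N. L - i)"
    unfolding inj_labels_def by (subst card_inj_on_subset_funcset) simp_all
  also have "\<dots> = (L choose N) * fact N"
    using assms
  proof (induction N)
    case (Suc N)
    have "(\<Prod>i=0..<Suc N. L - i) = (L choose N) * fact N * (L - N)"
      using Suc by simp
    also have "\<dots> = Suc N * (L choose Suc N) * fact N"
      by (simp only: binomial_absorption binomial_absorb_comp[symmetric] ac_simps)
    finally show ?case by (simp only: fact_Suc of_nat_id ac_simps)
  qed simp
  finally show ?thesis .
qed

text \<open>
  In quantum mechanics, this is the (unnormalised) Slater determinant of the orbitals
  \<open>\<psi> m (l 1), \<dots>, \<psi> m (l N)\<close> at the \<open>m\<close>-th coordinates of the configuration, or its bosonic analogue,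
  a permanent.
\<close>

definition slater :: "(nat \<Rightarrow> nat \<Rightarrow> 'a \<Rightarrow> complex) \<Rightarrow> nat \<Rightarrow> nat set \<Rightarrow> (nat \<Rightarrow> nat) \<Rightarrow> (nat \<Rightarrow> nat \<Rightarrow> 'a) \<Rightarrow> nat \<Rightarrow> complex" where
  "slater \<psi> N \<K> l x m = det_or_perm N (m \<in> \<K>) (\<lambda>i n. \<psi> m (l i) (x n m))"

lemma cnj_det_or_perm: "cnj (det_or_perm N s A) = det_or_perm N s (\<lambda>i n. cnj (A i n))"
  by (simp add: det_or_perm_def)

text \<open>
  The kernel is a sum of rank-one arrays whose two halves are complex conjugate, so every direction
  contributes a squared modulus. A direction in \<open>\<K>\<close> contributes a determinant, which vanishes
  when a label is repeated; this is where \<open>\<K> \<noteq> {}\<close> enters, and why only injective labellings remain.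
\<close>

lemma hyperdet_density_eq_sum_slater:
  assumes "\<K> \<subseteq> {1..M}" "\<K> \<noteq> {}"
  shows "hyperdet_density M L N (multi_kernel M L \<psi>) \<K> x =
    inverse (of_nat (L choose N) * fact N ^ M) *
      (1 / fact N * (\<Sum>l\<in>inj_labels N L. \<Prod>m=1..M. slater \<psi> N \<K> l x m * cnj (slater \<psi> N \<K> l x m)))"
proof -
  have kernel: "(\<lambda>i j. multi_kernel M L \<psi> (\<lambda>m\<in>{1..M}. x (i m)) (\<lambda>m\<in>{1..M}. x (j m))) =
      (\<lambda>i j. \<Sum>a\<in>{1..L}. \<Prod>m=1..M. \<psi> m a (x (i m) m) * cnj (\<psi> m a (x (j m) m)))"
    by (auto simp: multi_kernel_def lift_coord_def fun_eq_iff intro!: sum.cong prod.cong)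
  have "hyperdet M N \<K> (\<lambda>i j. multi_kernel M L \<psi> (\<lambda>m\<in>{1..M}. x (i m)) (\<lambda>m\<in>{1..M}. x (j m))) =
      1 / fact N * (\<Sum>l\<in>{1..N} \<rightarrow>\<^sub>E {1..L}.
        \<Prod>m=1..M. slater \<psi> N \<K> l x m * cnj (slater \<psi> N \<K> l x m))"
    unfolding kernel slater_def cnj_det_or_perm
    by (rule hyperdet_sum_of_rank_one[OF assms(1),
        where f = "\<lambda>m a n. \<psi> m a (x n m)" and g = "\<lambda>m a n. cnj (\<psi> m a (x n m))"]) simp
  also have "(\<Sum>l\<in>{1..N} \<rightarrow>\<^sub>E {1..L}. \<Prod>m=1..M. slater \<psi> N \<K> l x m * cnj (slater \<psi> N \<K> l x m)) =
      (\<Sum>l\<in>inj_labels N L. \<Prod>m=1..M. slater \<psi> N \<K> l x m * cnj (slater \<psi> N \<K> l x m))"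
  proof (intro sum.mono_neutral_right ballI)
    fix l assume "l \<in> ({1..N} \<rightarrow>\<^sub>E {1..L}) - inj_labels N L"
    then obtain a b where ab: "a \<in> {1..N}" "b \<in> {1..N}" "a \<noteq> b" "l a = l b"
      by (auto simp: inj_labels_def inj_on_def)
    from assms obtain k where k: "k \<in> \<K>" "k \<in> {1..M}" by blast
    have "slater \<psi> N \<K> l x k = 0"
      using ab k(1) det_or_perm_identical_rows[OF ab(1-3)] by (simp add: slater_def)
    with k(2) show "(\<Prod>m=1..M. slater \<psi> N \<K> l x m * cnj (slater \<psi> N \<K> l x m)) = 0"
      by (intro prod_zero bexI[of _ k]) auto
  qed (auto simp: inj_labels_def intro!: finite_PiE)
  finally show ?thesis
    unfolding hyperdet_density_def by (simp only:)
qed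

section \<open>Integration against orthonormal systems\<close>

text \<open>
  For injective \<open>l\<close> the product of Kronecker symbols forces \<open>\<sigma> = \<tau>\<close>, and then the two weights cancel,
  for either choice of character. Hence determinants and permanents have the same squared norm.
\<close>

lemma sum_weights_matching_permutations:
  assumes inj: "inj_on l {1..N}"
  shows "(\<Sum>(\<sigma>, \<tau>)\<in>{\<pi>. \<pi> permutes {1..N}} \<times> {\<pi>. \<pi> permutes {1..N}}.
      perm_weight s \<sigma> * perm_weight s \<tau> * (\<Prod>n=1..N. if l (\<sigma> n) = l (\<tau> n) then 1 else 0)) = fact N"
    (is "sum ?f (?P \<times> ?P) = _")
proof -
  have finP: "finite ?P" by (simp add: finite_permutations)
  have summand: "?f (\<sigma>, \<tau>) = (if \<tau> = \<sigma> then 1 else 0)" if "\<sigma> \<in> ?P" "\<tau> \<in> ?P" for \<sigma> \<tau>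
  proof (cases "\<sigma> = \<tau>")
    case False
    then obtain n where n: "\<sigma> n \<noteq> \<tau> n" by auto
    then have mem: "n \<in> {1..N}"
      using that by (metis mem_Collect_eq permutes_not_in)
    then have "\<sigma> n \<in> {1..N}" "\<tau> n \<in> {1..N}"
      using that by (metis mem_Collect_eq permutes_in_image)+
    with n inj have "l (\<sigma> n) \<noteq> l (\<tau> n)"
      by (metis inj_onD)
    with mem have "(\<Prod>n=1..N. if l (\<sigma> n) = l (\<tau> n) then 1 else 0 :: complex) = 0"
      by (intro prod_zero bexI[of _ n]) auto
    with False show ?thesis by auto
  qed simp
  have "sum ?f (?P \<times> ?P) = (\<Sum>\<sigma>\<in>?P. \<Sum>\<tau>\<in>?P. ?f (\<sigma>, \<tau>))"
    by (simp add: sum.cartesian_product)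
  also have "\<dots> = (\<Sum>\<sigma>\<in>?P. \<Sum>\<tau>\<in>?P. if \<tau> = \<sigma> then 1 else 0)"
    by (intro sum.cong refl summand)
  also have "\<dots> = of_nat (card ?P)"
    using finP by simp
  also have "card ?P = fact N"
    by (rule card_permutations) auto
  finally show ?thesis by simp
qed

lemma slater_mult_cnj:
  "slater \<psi> N \<K> l x m * cnj (slater \<psi> N \<K> l x m) =
    (\<Sum>(\<sigma>, \<tau>)\<in>{\<pi>. \<pi> permutes {1..N}} \<times> {\<pi>. \<pi> permutes {1..N}}.
      perm_weight (m \<in> \<K>) \<sigma> * perm_weight (m \<in> \<K>) \<tau> *
      (\<Prod>n=1..N. \<psi> m (l (\<sigma> n)) (x n m) * cnj (\<psi> m (l (\<tau> n)) (x n m))))"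
  unfolding slater_def cnj_det_or_perm unfolding det_or_perm_def sum_product sum.cartesian_product
  by (intro sum.cong refl) (auto simp: prod.distrib mult_ac)

lemma
  assumes "orthonormal_L2 \<nu> S f" "a \<in> S" "b \<in> S"
  shows integrable_orthonormal_pair: "integrable \<nu> (\<lambda>t. f a t * cnj (f b t))"
    and integral_orthonormal_pair: "(\<integral>t. f a t * cnj (f b t) \<partial>\<nu>) = (if a = b then 1 else 0)"
proof -
  have [measurable]: "f a \<in> borel_measurable \<nu>" "f b \<in> borel_measurable \<nu>"
    and sq: "integrable \<nu> (\<lambda>t. (cmod (f a t))\<^sup>2 + (cmod (f b t))\<^sup>2)"
    using assms by (auto simp: orthonormal_L2_def)
  have [measurable]: "(\<lambda>t. cnj (f b t)) \<in> borel_measurable \<nu>"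
    by (rule borel_measurable_continuous_on[where f = cnj]) (auto intro: continuous_intros)
  show "integrable \<nu> (\<lambda>t. f a t * cnj (f b t))"
  proof (rule Bochner_Integration.integrable_bound[OF sq])
    show "AE t in \<nu>. norm (f a t * cnj (f b t)) \<le> norm ((cmod (f a t))\<^sup>2 + (cmod (f b t))\<^sup>2)"
    proof (intro AE_I2)
      fix t
      have "0 \<le> cmod (f a t) * cmod (f b t)" by simp
      moreover have "2 * (cmod (f a t) * cmod (f b t)) \<le> (cmod (f a t))\<^sup>2 + (cmod (f b t))\<^sup>2"
        using sum_squares_bound[of "cmod (f a t)" "cmod (f b t)"] by (simp add: mult.assoc)
      ultimately have "cmod (f a t) * cmod (f b t) \<le> (cmod (f a t))\<^sup>2 + (cmod (f b t))\<^sup>2"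
        by linarith
      then show "norm (f a t * cnj (f b t)) \<le> norm ((cmod (f a t))\<^sup>2 + (cmod (f b t))\<^sup>2)"
        by (simp add: norm_mult)
    qed
  qed measurable
  show "(\<integral>t. f a t * cnj (f b t) \<partial>\<nu>) = (if a = b then 1 else 0)"
    using assms by (auto simp: orthonormal_L2_def)
qed

lemma inj_labels_permuted:
  assumes "l \<in> inj_labels N L" "\<pi> permutes {1..N}" "n \<in> {1..N}"
  shows "l (\<pi> n) \<in> {1..L}"
proof -
  from assms(2,3) have "\<pi> n \<in> {1..N}" by (simp only: permutes_in_image)
  with assms(1) show ?thesis unfolding inj_labels_def by (blast dest: PiE_mem)
qed

lemma
  fixes F :: "'i \<Rightarrow> 'a \<Rightarrow> 'b::{real_normed_field, banach, second_countable_topology}"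
  assumes F: "\<And>g. g \<in> S \<Longrightarrow> integrable M (F g)"
  shows integrable_linear_combination: "integrable M (\<lambda>x. \<Sum>g\<in>S. c g * F g x)"
    and integral_linear_combination: "(\<integral>x. (\<Sum>g\<in>S. c g * F g x) \<partial>M) = (\<Sum>g\<in>S. c g * (\<integral>x. F g x \<partial>M))"
  using F by (simp_all add: Bochner_Integration.integral_sum)

text \<open>
  Expanding all squared moduli turns the integrand into a linear combination of products of functions
  of a single variable \<open>x n m\<close>. Such products can be integrated over the nested product measure,
  first over the coordinates of each point and then over the points. Orthonormality leaves Kronecker
  symbols, and the remaining sum factorises over the directions \<open>m\<close>.
\<close>

lemma
  fixes \<mu> :: "nat \<Rightarrow> 'a measure"
  assumes orth: "\<And>m. m \<in> {1..M} \<Longrightarrow> orthonormal_L2 (\<mu> m) {1..L} (\<psi> m)"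
    and l: "l \<in> inj_labels N L"
  shows integrable_prod_slater: "integrable (PiM {1..N} (\<lambda>_. PiM {1..M} \<mu>))
      (\<lambda>x. \<Prod>m=1..M. slater \<psi> N \<K> l x m * cnj (slater \<psi> N \<K> l x m))"
    and integral_prod_slater: "(\<integral>x. (\<Prod>m=1..M. slater \<psi> N \<K> l x m * cnj (slater \<psi> N \<K> l x m))
      \<partial>PiM {1..N} (\<lambda>_. PiM {1..M} \<mu>)) = fact N ^ M"
proof -
  let ?P = "{\<pi>. \<pi> permutes {1..N}}"
  let ?Q = "PiM {1..N} (\<lambda>_. PiM {1..M} \<mu>)"
  define w where "w m p = perm_weight (m \<in> \<K>) (fst p) * perm_weight (m \<in> \<K>) (snd p)"
    for m and p :: "(nat \<Rightarrow> nat) \<times> (nat \<Rightarrow> nat)"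
  define h where "h m p n t = \<psi> m (l (fst p n)) t * cnj (\<psi> m (l (snd p n)) t)"
    for m t and n :: nat and p :: "(nat \<Rightarrow> nat) \<times> (nat \<Rightarrow> nat)"
  let ?S = "{1..M} \<rightarrow>\<^sub>E ?P \<times> ?P"
  have finP: "finite ?P" by (simp add: finite_permutations)
  have expand: "(\<Prod>m=1..M. slater \<psi> N \<K> l x m * cnj (slater \<psi> N \<K> l x m)) =
      (\<Sum>g\<in>?S. (\<Prod>m=1..M. w m (g m)) * (\<Prod>n=1..N. \<Prod>m=1..M. h m (g m) n (x n m)))" for x
  proof -
    have "(\<Prod>m=1..M. slater \<psi> N \<K> l x m * cnj (slater \<psi> N \<K> l x m)) =
        (\<Prod>m=1..M. \<Sum>p\<in>?P \<times> ?P. w m p * (\<Prod>n=1..N. h m p n (x n m)))"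
      unfolding slater_mult_cnj w_def h_def by (simp add: case_prod_beta)
    also have "\<dots> = (\<Sum>g\<in>?S. (\<Prod>m=1..M. w m (g m)) * (\<Prod>m=1..M. \<Prod>n=1..N. h m (g m) n (x n m)))"
      using finP by (subst prod_sum_PiE) (simp_all add: prod.distrib)
    also have "\<dots> = (\<Sum>g\<in>?S. (\<Prod>m=1..M. w m (g m)) * (\<Prod>n=1..N. \<Prod>m=1..M. h m (g m) n (x n m)))"
      by (intro sum.cong arg_cong2[where f = "(*)"] refl prod.swap)
    finally show ?thesis .
  qed
  have lab: "l (fst p n) \<in> {1..L}" "l (snd p n) \<in> {1..L}" if "p \<in> ?P \<times> ?P" "n \<in> {1..N}" for p n
  proof -
    from that(1) have "fst p permutes {1..N}" "snd p permutes {1..N}" by auto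
    with that(2) show "l (fst p n) \<in> {1..L}" "l (snd p n) \<in> {1..L}"
      by (blast intro: inj_labels_permuted[OF l])+
  qed
  have h: "integrable (\<mu> m) (h m (g m) n)"
      "(\<integral>t. h m (g m) n t \<partial>\<mu> m) = (if l (fst (g m) n) = l (snd (g m) n) then 1 else 0)"
    if "g \<in> ?S" "m \<in> {1..M}" "n \<in> {1..N}" for g m n
  proof -
    from that(1,2) have "g m \<in> ?P \<times> ?P" by (rule PiE_mem)
    note hyps = orth[OF that(2)] lab[OF this that(3)]
    show "integrable (\<mu> m) (h m (g m) n)"
      "(\<integral>t. h m (g m) n t \<partial>\<mu> m) = (if l (fst (g m) n) = l (snd (g m) n) then 1 else 0)"
      unfolding h_def using integrable_orthonormal_pair[OF hyps] integral_orthonormal_pair[OF hyps]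
      by simp_all
  qed
  have inner: "integrable (PiM {1..M} \<mu>) (\<lambda>y. \<Prod>m=1..M. h m (g m) n (y m))"
      "(\<integral>y. (\<Prod>m=1..M. h m (g m) n (y m)) \<partial>PiM {1..M} \<mu>) =
        (\<Prod>m=1..M. if l (fst (g m) n) = l (snd (g m) n) then 1 else 0)"
    if "g \<in> ?S" "n \<in> {1..N}" for g n
  proof -
    note int = h(1)[OF that(1) _ that(2)]
    show "integrable (PiM {1..M} \<mu>) (\<lambda>y. \<Prod>m=1..M. h m (g m) n (y m))"
      using int by (intro integrable_PiM_prod finite_atLeastAtMost)
    show "(\<integral>y. (\<Prod>m=1..M. h m (g m) n (y m)) \<partial>PiM {1..M} \<mu>) =
        (\<Prod>m=1..M. if l (fst (g m) n) = l (snd (g m) n) then 1 else 0)"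
      using int by (subst integral_PiM_prod) (auto intro!: prod.cong h(2)[OF that(1) _ that(2)])
  qed
  have outer: "integrable ?Q (\<lambda>x. \<Prod>n=1..N. \<Prod>m=1..M. h m (g m) n (x n m))"
      "(\<integral>x. (\<Prod>n=1..N. \<Prod>m=1..M. h m (g m) n (x n m)) \<partial>?Q) =
        (\<Prod>n=1..N. \<Prod>m=1..M. if l (fst (g m) n) = l (snd (g m) n) then 1 else 0)"
    if "g \<in> ?S" for g
  proof -
    note int = inner(1)[OF that]
    show "integrable ?Q (\<lambda>x. \<Prod>n=1..N. \<Prod>m=1..M. h m (g m) n (x n m))"
      using int by (intro integrable_PiM_prod[where f = "\<lambda>n y. \<Prod>m=1..M. h m (g m) n (y m)"]
        finite_atLeastAtMost)
    show "(\<integral>x. (\<Prod>n=1..N. \<Prod>m=1..M. h m (g m) n (x n m)) \<partial>?Q) =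
        (\<Prod>n=1..N. \<Prod>m=1..M. if l (fst (g m) n) = l (snd (g m) n) then 1 else 0)"
      using int inner(2)[OF that]
      by (subst integral_PiM_prod[where f = "\<lambda>n y. \<Prod>m=1..M. h m (g m) n (y m)"]) auto
  qed
  show "integrable ?Q (\<lambda>x. \<Prod>m=1..M. slater \<psi> N \<K> l x m * cnj (slater \<psi> N \<K> l x m))"
    unfolding expand using outer(1) by (rule integrable_linear_combination)
  have "(\<integral>x. (\<Prod>m=1..M. slater \<psi> N \<K> l x m * cnj (slater \<psi> N \<K> l x m)) \<partial>?Q) =
      (\<Sum>g\<in>?S. (\<Prod>m=1..M. w m (g m)) * (\<integral>x. (\<Prod>n=1..N. \<Prod>m=1..M. h m (g m) n (x n m)) \<partial>?Q))"
    unfolding expand using outer(1) by (rule integral_linear_combination)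
  also have "\<dots> = (\<Sum>g\<in>?S. (\<Prod>m=1..M. w m (g m)) *
      (\<Prod>n=1..N. \<Prod>m=1..M. if l (fst (g m) n) = l (snd (g m) n) then 1 else 0))"
    by (simp only: outer(2) cong: sum.cong)
  also have "\<dots> = (\<Sum>g\<in>?S. (\<Prod>m=1..M. w m (g m)) *
      (\<Prod>m=1..M. \<Prod>n=1..N. if l (fst (g m) n) = l (snd (g m) n) then 1 else 0))"
    by (intro sum.cong arg_cong2[where f = "(*)"] refl prod.swap)
  also have "\<dots> = (\<Sum>g\<in>?S. \<Prod>m=1..M. w m (g m) * (\<Prod>n=1..N. if l (fst (g m) n) = l (snd (g m) n) then 1 else 0))"
    by (simp only: prod.distrib)
  also have "\<dots> = (\<Prod>m=1..M. \<Sum>p\<in>?P \<times> ?P. w m p * (\<Prod>n=1..N. if l (fst p n) = l (snd p n) then 1 else 0))"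
    using finP by (subst prod_sum_PiE) simp_all
  also have "\<dots> = (\<Prod>m=1..M. fact N)"
    using l sum_weights_matching_permutations[of l N]
    by (intro prod.cong refl) (simp add: w_def inj_labels_def case_prod_beta)
  finally show "(\<integral>x. (\<Prod>m=1..M. slater \<psi> N \<K> l x m * cnj (slater \<psi> N \<K> l x m)) \<partial>?Q) = fact N ^ M"
    by simp
qed

text \<open>
  For integrating out the last direction: the computation above with a single direction, where a
  point \<open>u n\<close> is just one coordinate.
\<close>

lemma
  assumes orth: "orthonormal_L2 \<nu> {1..L} (\<psi> m)" and l: "l \<in> inj_labels N L"
  shows integrable_slater: "integrable (PiM {1..N} (\<lambda>_. \<nu>))
      (\<lambda>u. slater \<psi> N \<K> l (\<lambda>n _. u n) m * cnj (slater \<psi> N \<K> l (\<lambda>n _. u n) m))"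
    and integral_slater: "(\<integral>u. slater \<psi> N \<K> l (\<lambda>n _. u n) m * cnj (slater \<psi> N \<K> l (\<lambda>n _. u n) m)
      \<partial>PiM {1..N} (\<lambda>_. \<nu>)) = fact N"
proof -
  let ?P = "{\<pi>. \<pi> permutes {1..N}}"
  let ?Q = "PiM {1..N} (\<lambda>_. \<nu>)"
  let ?h = "\<lambda>\<sigma> \<tau> n t. \<psi> m (l (\<sigma> n)) t * cnj (\<psi> m (l (\<tau> n)) t)"
  have lab: "l (\<sigma> n) \<in> {1..L}" if "\<sigma> \<in> ?P" "n \<in> {1..N}" for \<sigma> n
    using that by (blast intro: inj_labels_permuted[OF l])
  have h: "integrable ?Q (\<lambda>u. \<Prod>n=1..N. ?h \<sigma> \<tau> n (u n))"
      "(\<integral>u. (\<Prod>n=1..N. ?h \<sigma> \<tau> n (u n)) \<partial>?Q) = (\<Prod>n=1..N. if l (\<sigma> n) = l (\<tau> n) then 1 else 0)"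
    if "\<sigma> \<in> ?P" "\<tau> \<in> ?P" for \<sigma> \<tau>
  proof -
    have int: "integrable \<nu> (?h \<sigma> \<tau> n)" if "n \<in> {1..N}" for n
      using lab \<open>\<sigma> \<in> ?P\<close> \<open>\<tau> \<in> ?P\<close> that by (intro integrable_orthonormal_pair[OF orth]) auto
    then show "integrable ?Q (\<lambda>u. \<Prod>n=1..N. ?h \<sigma> \<tau> n (u n))"
      by (intro integrable_PiM_prod) auto
    show "(\<integral>u. (\<Prod>n=1..N. ?h \<sigma> \<tau> n (u n)) \<partial>?Q) = (\<Prod>n=1..N. if l (\<sigma> n) = l (\<tau> n) then 1 else 0)"
      using lab that int integral_orthonormal_pair[OF orth]
      by (subst integral_PiM_prod) (auto intro!: prod.cong)
  qed
  show "integrable ?Q (\<lambda>u. slater \<psi> N \<K> l (\<lambda>n _. u n) m * cnj (slater \<psi> N \<K> l (\<lambda>n _. u n) m))"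
    unfolding slater_mult_cnj case_prod_beta
    by (rule integrable_linear_combination) (use h(1) in auto)
  have "(\<integral>u. slater \<psi> N \<K> l (\<lambda>n _. u n) m * cnj (slater \<psi> N \<K> l (\<lambda>n _. u n) m) \<partial>?Q) =
      (\<Sum>p\<in>?P \<times> ?P. perm_weight (m \<in> \<K>) (fst p) * perm_weight (m \<in> \<K>) (snd p) *
        (\<integral>u. (\<Prod>n=1..N. ?h (fst p) (snd p) n (u n)) \<partial>?Q))"
    unfolding slater_mult_cnj case_prod_beta
    by (rule integral_linear_combination) (use h(1) in auto)
  also have "\<dots> = (\<Sum>p\<in>?P \<times> ?P. perm_weight (m \<in> \<K>) (fst p) * perm_weight (m \<in> \<K>) (snd p) *
      (\<Prod>n=1..N. if l (fst p n) = l (snd p n) then 1 else 0))"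
    using h(2) by (intro sum.cong refl arg_cong2[where f = "(*)"]) auto
  also have "\<dots> = fact N"
    using l sum_weights_matching_permutations[of l N] by (simp add: inj_labels_def case_prod_beta)
  finally show "(\<integral>u. slater \<psi> N \<K> l (\<lambda>n _. u n) m * cnj (slater \<psi> N \<K> l (\<lambda>n _. u n) m) \<partial>?Q) = fact N" .
qed

section \<open>The marginal density\<close>

lemma slater_cong:
  assumes "\<And>n. n \<in> {1..N} \<Longrightarrow> x n m = y n m" and "m \<in> \<K> \<longleftrightarrow> m \<in> \<K>'"
  shows "slater \<psi> N \<K> l x m = slater \<psi> N \<K>' l y m"
  using assms by (auto simp: slater_def det_or_perm_def intro!: sum.cong prod.cong)

text \<open>
  The function is a nonnegative combination of squared moduli, and each of the \<open>(L choose N) * fact N\<close>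
  injective labellings contributes \<open>fact N ^ M\<close> to the integral. The normalising constant compensates
  exactly for this, together with the factor \<open>1 / fact N\<close> of the hyperdeterminant.
\<close>

lemma is_probability_density_hyperdet_density:
  fixes \<mu> :: "nat \<Rightarrow> 'a measure"
  assumes "N \<le> L" and \<K>: "\<K> \<subseteq> {1..M}" "\<K> \<noteq> {}"
    and orth: "\<And>m. m \<in> {1..M} \<Longrightarrow> orthonormal_L2 (\<mu> m) {1..L} (\<psi> m)"
  shows "is_probability_density (PiM {1..N} (\<lambda>_. PiM {1..M} \<mu>))
    (hyperdet_density M L N (multi_kernel M L \<psi>) \<K>)"
proof -
  let ?Q = "PiM {1..N} (\<lambda>_. PiM {1..M} \<mu>)"
  let ?f = "hyperdet_density M L N (multi_kernel M L \<psi>) \<K>"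
  note eq = hyperdet_density_eq_sum_slater[OF \<K>, of L N \<psi>]
  have int: "integrable ?Q ?f"
    unfolding eq[abs_def] using integrable_prod_slater[OF orth]
    by (intro integrable_mult_right Bochner_Integration.integrable_sum) auto
  have "(\<integral>x. ?f x \<partial>?Q) = inverse (of_nat (L choose N) * fact N ^ M) *
      (1 / fact N * (\<Sum>l\<in>inj_labels N L. fact N ^ M))"
    unfolding eq[abs_def] using integrable_prod_slater[OF orth] integral_prod_slater[OF orth]
    by (simp add: Bochner_Integration.integral_sum)
  also have "\<dots> = 1"
    using \<open>N \<le> L\<close> by (simp add: card_inj_labels field_simps)
  finally have total: "(\<integral>x. ?f x \<partial>?Q) = 1" .
  have real: "?f x \<in> \<real> \<and> 0 \<le> Re (?f x)" for x
  proof -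
    have "?f x = of_real (inverse (of_nat (L choose N) * fact N ^ M) *
        (1 / fact N * (\<Sum>l\<in>inj_labels N L. \<Prod>m=1..M. (cmod (slater \<psi> N \<K> l x m))\<^sup>2)))"
      unfolding eq by (simp flip: complex_norm_square)
    also have "\<dots> \<in> \<real>" "0 \<le> Re \<dots>"
      by (simp_all only: Reals_of_real Re_complex_of_real, intro mult_nonneg_nonneg sum_nonneg prod_nonneg) auto
    ultimately show ?thesis by simp
  qed
  have "prob_space (density ?Q (\<lambda>x. ennreal (Re (?f x))))"
  proof (rule prob_spaceI)
    have "emeasure (density ?Q (\<lambda>x. ennreal (Re (?f x)))) (space ?Q) = (\<integral>\<^sup>+x. ennreal (Re (?f x)) \<partial>?Q)"
      using int by (subst emeasure_density) (auto intro!: nn_integral_cong)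
    also have "\<dots> = ennreal (\<integral>x. Re (?f x) \<partial>?Q)"
      using int real by (intro nn_integral_eq_integral) auto
    also have "(\<integral>x. Re (?f x) \<partial>?Q) = 1"
      using int total by simp
    finally show "emeasure (density ?Q (\<lambda>x. ennreal (Re (?f x))))
        (space (density ?Q (\<lambda>x. ennreal (Re (?f x))))) = 1"
      by simp
  qed
  with int real show ?thesis
    by (auto simp: is_probability_density_def)
qed

text \<open>
  In the sum over injective labellings only the factor of the last direction depends on \<open>u\<close>. Its
  integral is \<open>fact N\<close> whether this factor is a determinant or a permanent, and this is the quotient
  of the two normalising constants. A remaining direction with the sign character ensures that the
  density in one dimension less is a sum over the same labellings.
\<close>

lemma
  fixes M L N :: nat and \<nu> :: "'a measure"
  assumes \<K>: "\<K> \<subseteq> {1..Suc M}" "\<K> - {Suc M} \<noteq> {}"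
    and orth: "orthonormal_L2 \<nu> {1..L} (\<psi> (Suc M))"
  shows integrable_last_coordinate: "integrable (PiM {1..N} (\<lambda>_. \<nu>))
      (\<lambda>u. hyperdet_density (Suc M) L N (multi_kernel (Suc M) L \<psi>) \<K> (extend_config (Suc M) N x u))"
    and integral_last_coordinate: "(\<integral>u. hyperdet_density (Suc M) L N (multi_kernel (Suc M) L \<psi>) \<K>
        (extend_config (Suc M) N x u) \<partial>PiM {1..N} (\<lambda>_. \<nu>)) =
      hyperdet_density M L N (multi_kernel M L \<psi>) (\<K> - {Suc M}) x"
proof -
  let ?p = "\<lambda>u. hyperdet_density (Suc M) L N (multi_kernel (Suc M) L \<psi>) \<K> (extend_config (Suc M) N x u)"
  let ?Q = "PiM {1..N} (\<lambda>_. \<nu>)"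
  define c where "c k = inverse (of_nat (L choose N) * fact N ^ k :: complex)" for k
  define D where "D l = (\<Prod>m=1..M. slater \<psi> N (\<K> - {Suc M}) l x m * cnj (slater \<psi> N (\<K> - {Suc M}) l x m))" for l
  define E where "E l u = slater \<psi> N \<K> l (\<lambda>n _. u n) (Suc M) * cnj (slater \<psi> N \<K> l (\<lambda>n _. u n) (Suc M))" for l u
  have E: "integrable ?Q (E l)" "(\<integral>u. E l u \<partial>?Q) = fact N" if "l \<in> inj_labels N L" for l
    unfolding E_def using orth that by (rule integrable_slater, rule integral_slater)
  have last: "slater \<psi> N \<K> l (extend_config (Suc M) N x u) (Suc M) = slater \<psi> N \<K> l (\<lambda>n _. u n) (Suc M)" for l u
    by (rule slater_cong) (auto simp: extend_config_def)
  have other: "slater \<psi> N \<K> l (extend_config (Suc M) N x u) m = slater \<psi> N (\<K> - {Suc M}) l x m"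
    if "m \<in> {1..M}" for l u m
    using that by (intro slater_cong) (auto simp: extend_config_def)
  have p: "?p u = c (Suc M) * (1 / fact N * (\<Sum>l\<in>inj_labels N L. D l * E l u))" for u
  proof -
    have "\<K> \<noteq> {}" using \<K> by auto
    show ?thesis
      unfolding hyperdet_density_eq_sum_slater[OF \<K>(1) \<open>\<K> \<noteq> {}\<close>] c_def D_def E_def
      by (simp add: last other)
  qed
  show "integrable ?Q ?p"
    unfolding p using integrable_linear_combination[OF E(1)] by (intro integrable_mult_right)
  have "(\<integral>u. ?p u \<partial>?Q) = c (Suc M) * (1 / fact N * (\<Sum>l\<in>inj_labels N L. D l * fact N))"
    unfolding p using integral_linear_combination[OF E(1), where c = D] E(2) by simp
  also have "\<dots> = c M * (1 / fact N * (\<Sum>l\<in>inj_labels N L. D l))"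
    by (simp add: c_def field_simps flip: sum_distrib_right)
  also have "\<dots> = hyperdet_density M L N (multi_kernel M L \<psi>) (\<K> - {Suc M}) x"
  proof -
    have "\<K> - {Suc M} \<subseteq> {1..M}" using \<K> by (auto simp: le_Suc_eq)
    then show ?thesis
      unfolding c_def D_def using \<K>(2) by (rule hyperdet_density_eq_sum_slater[symmetric])
  qed
  finally show "(\<integral>u. ?p u \<partial>?Q) = hyperdet_density M L N (multi_kernel M L \<psi>) (\<K> - {Suc M}) x" .
qed

theorem theorem4p1:
  fixes M L N :: nat
    and \<K> :: "nat set"
    and \<mu> :: "nat \<Rightarrow> 'a measure"
    and \<psi> :: "nat \<Rightarrow> nat \<Rightarrow> 'a \<Rightarrow> complex"
  assumes "1 \<le> M" and "1 \<le> L" and "1 \<le> N" and "N \<le> L"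
    and "\<K> \<subseteq> {1..M}" and "\<K> \<noteq> {}"
    and "\<And>m. m \<in> {1..M} \<Longrightarrow> orthonormal_L2 (\<mu> m) {1..L} (\<psi> m)"
    and "M \<notin> \<K> \<or> (M \<in> \<K> \<and> \<K> - {M} \<noteq> {})"
  shows
    "let p = hyperdet_density M L N (multi_kernel M L \<psi>) \<K>;
         \<mu>_last = PiM {1..N} (\<lambda>_. \<mu> M);
         \<mu>_hat_N = PiM {1..N} (\<lambda>_. PiM {1..M - 1} \<mu>);
         p_hat = (\<lambda>x. \<integral>u. p (extend_config M N x u) \<partial>\<mu>_last)
     in (\<forall>x\<in>space \<mu>_hat_N. integrable \<mu>_last (\<lambda>u. p (extend_config M N x u))) \<and>
        is_probability_density \<mu>_hat_N p_hat \<and>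
        (\<forall>x\<in>space \<mu>_hat_N.
           p_hat x = hyperdet_density (M - 1) L N (multi_kernel (M - 1) L \<psi>) (\<K> - {M}) x)"
proof -
  obtain k where M: "M = Suc k"
    using \<open>1 \<le> M\<close> by (cases M) auto
  have \<K>: "\<K> \<subseteq> {1..Suc k}" "\<K> - {Suc k} \<noteq> {}"
    using assms(5,6,8) by (auto simp: M)
  have orth: "orthonormal_L2 (\<mu> (Suc k)) {1..L} (\<psi> (Suc k))"
    using assms(7)[of M] by (simp add: M)
  have "\<K> - {Suc k} \<subseteq> {1..k}"
    using \<K>(1) by (auto simp: le_Suc_eq)
  then have "is_probability_density (PiM {1..N} (\<lambda>_. PiM {1..k} \<mu>))
      (hyperdet_density k L N (multi_kernel k L \<psi>) (\<K> - {Suc k}))"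
    using \<open>N \<le> L\<close> \<K>(2) assms(7) by (intro is_probability_density_hyperdet_density) (auto simp: M)
  moreover note int = integrable_last_coordinate[where \<psi> = \<psi> and \<nu> = "\<mu> (Suc k)", OF \<K> orth]
    and marginal = integral_last_coordinate[where \<psi> = \<psi> and \<nu> = "\<mu> (Suc k)", OF \<K> orth]
  ultimately show ?thesis
    unfolding Let_def M diff_Suc_1 marginal
    using int by blast
qed

end
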